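(* Let $G$ be a finite directed graph with no sinks that satisfies Condition (L). For any $[x]\in\mathrm{coker}(A_G-I)$, where $A_G-I:\prod_{G^0}\mathbb{Z}\to\prod_{G^0}\mathbb{Z}$, there exists an essential 1-sink extension $E$ of $G$ such that $[\omega_E]=[x]$ in $\mathrm{coker}(A_G-I)$, where $\omega_E$ denotes the Wojciech vector of $E$.
   Context: A directed graph $G=(G^0,G^1,r,s)$ has a countable set $G^0$ of vertices, a countable set $G^1$ of edges, and range and source maps $r,s:G^1\to G^0$; it is finite if $G^0$ and $G^1$ are finite, and row-finite if each vertex emits only finitely many edges. A sink is a vertex $v$ with $s^{-1}(v)=\emptyset$; a source is a vertex $v$ with $r^{-1}(v)=\emptyset$. A path is a finite sequence of edges $\alpha=\alpha_1\cdots\alpha_n$ with $r(\alpha_i)=s(\alpha_{i+1})$, $|\alpha|=n$; a loop is a path $x=x_1\cdots x_n$ ($n\ge1$) whose range and source are equal; an exit for it is an edge $e$ with $s(e)=s(x_i)$ and $e\ne x_i$ for some $i$. Condition (L): every loop has an exit. The vertex matrix $A_G$ is the $G^0\times G^0$ matrix $A_G(v,w)=\#\{e\in G^1:s(e)=v,r(e)=w\}$, acting on $\prod_{G^0}\mathbb{Z}$ by left multiplication. A 1-sink extension $(E,v_0)$ of a row-finite graph $G$ is a row-finite graph $E$ containing $G$ as a subgraph such that (1) $H:=E^0\setminus G^0$ is finite, contains no sources, and contains exactly one sink $v_0$; (2) there are no loops in $E$ whose vertices lie in $H$; (3) if $e\in E^1\setminus G^1$ then $r(e)\in H$; (4) if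 $w$ is a sink in $G$ then $w$ is a sink in $E$. It is essential if for every $v\in G^0$ there is a path in $E$ from $v$ to $v_0$. The Wojciech vector $\omega_E\in\prod_{G^0}\mathbb{N}$ ($\mathbb{N}$ contains $0$) is $\omega_E(w):=\#Z(w,v_0)$, where $Z(w,v_0)$ is the set of paths $\alpha$ from $w$ to $v_0$ with $\alpha_i\in E^1\setminus G^1$ for all $1\le i\le|\alpha|$. *)

theory Defs
  imports
    "HOL-Algebra.Product_Groups"
    "HOL-Library.Countable_Set"
    "Graph_Theory.Digraph"
    "Graph_Theory.Arc_Walk"
begin

text \<open>
  Graphs are the digraphs with named arcs of the Graph_Theory library:
  \<open>verts\<close> is $G^0$, \<open>arcs\<close> is $G^1$, \<open>tail\<close> is the source map $s$ and \<open>head\<close> is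
  the range map $r$.  Since $r(\alpha_i) = s(\alpha_{i+1})$ along a path, paths
  are the library's \<open>awalk\<close>s.  The library allows the null graph.
\<close>

definition row_finite_graph :: "('a, 'b) pre_digraph \<Rightarrow> bool" where
  "row_finite_graph G \<longleftrightarrow>
     wf_digraph G \<and> countable (verts G) \<and> countable (arcs G) \<and>
     (\<forall>v \<in> verts G. finite (out_arcs G v))"

definition is_sink :: "('a, 'b) pre_digraph \<Rightarrow> 'a \<Rightarrow> bool" where
  "is_sink G v \<longleftrightarrow> v \<in> verts G \<and> out_arcs G v = {}"

definition is_source :: "('a, 'b) pre_digraph \<Rightarrow> 'a \<Rightarrow> bool" where
  "is_source G v \<longleftrightarrow> v \<in> verts G \<and> in_arcs G v = {}"

text \<open>
  Vertices of a loop may be repeated, unlike in the library's \<open>cycle\<close>.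
\<close>

definition is_loop :: "('a, 'b) pre_digraph \<Rightarrow> 'b list \<Rightarrow> bool" where
  "is_loop G p \<longleftrightarrow> p \<noteq> [] \<and> (\<exists>u. pre_digraph.awalk G u p u)"

definition has_exit :: "('a, 'b) pre_digraph \<Rightarrow> 'b list \<Rightarrow> bool" where
  "has_exit G p \<longleftrightarrow>
     (\<exists>e \<in> arcs G. \<exists>i < length p. tail G e = tail G (p ! i) \<and> e \<noteq> p ! i)"

definition condition_L :: "('a, 'b) pre_digraph \<Rightarrow> bool" where
  "condition_L G \<longleftrightarrow> (\<forall>p. is_loop G p \<longrightarrow> has_exit G p)"

text \<open>
  The library's \<open>subgraph\<close> requires the source and range maps to agree as total
  functions, hence also on elements of the arc type that are not arcs of the
  subgraph; here they need only agree on its arcs.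
\<close>

definition contains_subgraph ::
  "('a, 'b) pre_digraph \<Rightarrow> ('a, 'b) pre_digraph \<Rightarrow> bool" where
  "contains_subgraph E G \<longleftrightarrow>
     verts G \<subseteq> verts E \<and> arcs G \<subseteq> arcs E \<and>
     (\<forall>e \<in> arcs G. tail E e = tail G e \<and> head E e = head G e)"

definition one_sink_extension ::
  "('a, 'b) pre_digraph \<Rightarrow> ('a, 'b) pre_digraph \<Rightarrow> 'a \<Rightarrow> bool" where
  "one_sink_extension G E v0 \<longleftrightarrow>
     row_finite_graph G \<and> row_finite_graph E \<and> contains_subgraph E G \<and>
     (let H = verts E - verts G in
        finite H \<and>
        (\<forall>v \<in> H. \<not> is_source E v) \<and>
        {v \<in> H. is_sink E v} = {v0} \<and>
        \<not> (\<exists>p. is_loop E p \<and> (\<forall>e \<in> set p. tail E e \<in> H)) \<and>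
        (\<forall>e \<in> arcs E - arcs G. head E e \<in> H)) \<and>
     (\<forall>w. is_sink G w \<longrightarrow> is_sink E w)"

definition essential_one_sink_extension ::
  "('a, 'b) pre_digraph \<Rightarrow> ('a, 'b) pre_digraph \<Rightarrow> 'a \<Rightarrow> bool" where
  "essential_one_sink_extension G E v0 \<longleftrightarrow>
     one_sink_extension G E v0 \<and>
     (\<forall>v \<in> verts G. \<exists>p. pre_digraph.awalk E v p v0)"

text \<open>
  For a 1-sink extension this set of paths is finite, because every arc outside
  \<open>G\<close> ends in the finite loop-free part \<open>H\<close>, so \<open>card\<close> is the true count.
\<close>

definition wojciech_vector ::
  "('a, 'b) pre_digraph \<Rightarrow> ('a, 'b) pre_digraph \<Rightarrow> 'a \<Rightarrow> 'a \<Rightarrow> nat" where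
  "wojciech_vector G E v0 w =
     card {p. pre_digraph.awalk E w p v0 \<and> set p \<subseteq> arcs E - arcs G}"

definition vertex_matrix :: "('a, 'b) pre_digraph \<Rightarrow> 'a \<Rightarrow> 'a \<Rightarrow> nat" where
  "vertex_matrix G v w = card {e \<in> arcs G. tail G e = v \<and> head G e = w}"

definition int_power :: "'a set \<Rightarrow> ('a \<Rightarrow> int) monoid" where
  "int_power V = product_group V (\<lambda>_. integer_group)"

text \<open>
  The operator $A_G - I$ on $\prod_{G^0} \mathbf{Z}$.  The sum runs over the
  nonzero entries of a row, which are finitely many in a row-finite graph.
\<close>

definition vertex_matrix_minus_id ::
  "('a, 'b) pre_digraph \<Rightarrow> ('a \<Rightarrow> int) \<Rightarrow> 'a \<Rightarrow> int" where
  "vertex_matrix_minus_id G x =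
     (\<lambda>v \<in> verts G.
        (\<Sum>w | w \<in> verts G \<and> vertex_matrix G v w \<noteq> 0.
           int (vertex_matrix G v w) * x w) - x v)"

definition image_subgroup :: "('a, 'b) pre_digraph \<Rightarrow> ('a \<Rightarrow> int) set" where
  "image_subgroup G = vertex_matrix_minus_id G ` carrier (int_power (verts G))"

definition coker_vertex_matrix_minus_id ::
  "('a, 'b) pre_digraph \<Rightarrow> ('a \<Rightarrow> int) set monoid" where
  "coker_vertex_matrix_minus_id G = int_power (verts G) Mod image_subgroup G"

definition coker_class ::
  "('a, 'b) pre_digraph \<Rightarrow> ('a \<Rightarrow> int) \<Rightarrow> ('a \<Rightarrow> int) set" where
  "coker_class G x =
     image_subgroup G #>\<^bsub>int_power (verts G)\<^esub> (\<lambda>v \<in> verts G. x v)"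

text \<open>
  The same graph, relabelled into types that have infinitely many further names
  available.  An extension needs vertices and arcs outside \<open>G\<close>, and the types of
  \<open>G\<close> itself may be exhausted by \<open>G\<close>.  The maps are irrelevant on \<open>Inr\<close>.
\<close>

definition inl_copy :: "('a, 'b) pre_digraph \<Rightarrow> ('a + nat, 'b + nat) pre_digraph" where
  "inl_copy G =
     \<lparr>verts = Inl ` verts G, arcs = Inl ` arcs G,
      tail = map_sum (tail G) id, head = map_sum (head G) id\<rparr>"

end

theory Submission
  imports Defs
begin

text \<open>
  If $u_k(v)$ counts the paths of length $k$ from $v$, then $(A_G - I) u_k = u_{k+1} - u_k$, so
  $(A_G - I) \sum_{k<n} u_k = u_n - u_0 = u_n - 1$.  As $G$ has no sinks, $u_k$ is nondecreasing in
  $k$, and by Condition (L) every vertex eventually has two paths: the vertices with a single path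
  of each length emit exactly one edge each, towards a vertex of the same kind, and following these
  edges would give a loop without exit.  Hence the image of $A_G - I$ contains a strictly positive
  vector, and every class of the cokernel has a strictly positive representative $n$.  Adding one
  vertex $v_0$ to $G$ and $n(w)$ edges from each $w$ to $v_0$ yields an essential 1-sink extension
  with Wojciech vector $n$.
\<close>

section \<open>Matrix rows as sums over outgoing edges\<close>

lemma out_arcs_finite: "fin_digraph G \<Longrightarrow> finite (out_arcs G v)"
  by (simp add: out_arcs_def fin_digraph.finite_arcs)

text \<open>Grouping the edges that leave \<open>v\<close> by their range gives back the matrix row.
  In the edge form, linearity and the recursion for path counts can be read off.\<close>

lemma vertex_matrix_minus_id_eq:
  assumes "fin_digraph G" and v: "v \<in> verts G"
  shows "vertex_matrix_minus_id G y v = (\<Sum>e\<in>out_arcs G v. y (head G e)) - y v"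
proof -
  interpret fin_digraph G by fact
  have "(\<Sum>e\<in>out_arcs G v. y (head G e)) =
      (\<Sum>w\<in>verts G. \<Sum>e | e \<in> out_arcs G v \<and> head G e = w. y (head G e))"
    by (rule sum.group[symmetric]) (auto simp: out_arcs_finite[OF assms(1)])
  also have "\<dots> = (\<Sum>w\<in>verts G. int (vertex_matrix G v w) * y w)"
    by (intro sum.cong) (auto simp: vertex_matrix_def conj_assoc)
  also have "\<dots> = (\<Sum>w | w \<in> verts G \<and> vertex_matrix G v w \<noteq> 0. int (vertex_matrix G v w) * y w)"
    by (rule sum.mono_neutral_right) auto
  finally show ?thesis
    using v by (simp add: vertex_matrix_minus_id_def)
qed

section \<open>A positive vector in the image\<close>

text \<open>For a finite graph this is, on vertices, A_G^k applied to the constant vector 1; the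
  recursion splits off the first edge of a path.\<close>

primrec path_count :: "('a, 'b) pre_digraph \<Rightarrow> nat \<Rightarrow> 'a \<Rightarrow> nat" where
  "path_count G 0 v = 1"
| "path_count G (Suc k) v = (\<Sum>e\<in>out_arcs G v. path_count G k (head G e))"

lemma vertex_matrix_minus_id_path_count_sum:
  assumes "fin_digraph G" and "v \<in> verts G"
  shows "vertex_matrix_minus_id G (\<lambda>v. \<Sum>k<n. int (path_count G k v)) v = int (path_count G n v) - 1"
proof -
  have "(\<Sum>e\<in>out_arcs G v. \<Sum>k<n. int (path_count G k (head G e))) =
      (\<Sum>k<n. int (path_count G (Suc k) v))"
    by (subst sum.swap) simp
  then have "vertex_matrix_minus_id G (\<lambda>v. \<Sum>k<n. int (path_count G k v)) v =
      (\<Sum>k<n. int (path_count G (Suc k) v) - int (path_count G k v))"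
    using assms by (simp only: vertex_matrix_minus_id_eq sum_subtractf)
  also have "\<dots> = int (path_count G n v) - 1"
    by (subst sum_lessThan_telescope) simp
  finally show ?thesis .
qed

text \<open>The absence of sinks settles length 0, and A_G, having nonnegative entries, preserves
  the inequality.\<close>

lemma path_count_le_Suc:
  assumes G: "fin_digraph G" and ns: "\<forall>v\<in>verts G. \<not> is_sink G v" and "v \<in> verts G"
  shows "path_count G k v \<le> path_count G (Suc k) v"
  using \<open>v \<in> verts G\<close>
proof (induction k arbitrary: v)
  case 0
  then have "out_arcs G v \<noteq> {}"
    using ns by (auto simp: is_sink_def)
  then show ?case
    using out_arcs_finite[OF G, of v] by (simp add: Suc_le_eq card_gt_0_iff)
next
  case (Suc k)
  interpret fin_digraph G by fact
  have "(\<Sum>e\<in>out_arcs G v. path_count G k (head G e)) \<le>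
      (\<Sum>e\<in>out_arcs G v. path_count G (Suc k) (head G e))"
    by (rule sum_mono) (auto simp del: path_count.simps intro!: Suc.IH)
  then show ?case by simp
qed

lemma path_count_mono:
  assumes "fin_digraph G" and "\<forall>v\<in>verts G. \<not> is_sink G v" and "v \<in> verts G" and "j \<le> k"
  shows "path_count G j v \<le> path_count G k v"
  using path_count_le_Suc[OF assms(1-3)] \<open>j \<le> k\<close> by (rule lift_Suc_mono_le)

text \<open>Here \<open>a\<close> selects an outgoing edge at each vertex of \<open>T\<close>, never
  leaving \<open>T\<close>. The end of the path is given as an iterate so that a repetition in the
  orbit closes up to a loop.\<close>

lemma awalk_iterates:
  assumes wf: "wf_digraph G"
    and a: "\<And>w. w \<in> T \<Longrightarrow> a w \<in> arcs G \<and> tail G (a w) = w \<and> head G (a w) \<in> T"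
    and "T \<subseteq> verts G" and "v \<in> T"
  shows "\<exists>p. length p = m \<and> pre_digraph.awalk G v p (((\<lambda>w. head G (a w)) ^^ m) v) \<and>
           set p \<subseteq> a ` T \<and> ((\<lambda>w. head G (a w)) ^^ m) v \<in> T"
  using \<open>v \<in> T\<close>
proof (induction m arbitrary: v)
  case 0
  interpret wf_digraph G by fact
  from 0 show ?case using \<open>T \<subseteq> verts G\<close> by (auto simp: awalk_simps)
next
  case (Suc m)
  interpret wf_digraph G by fact
  from Suc.IH[of "head G (a v)"] a[OF Suc.prems] obtain p where
    "length p = m" "awalk (head G (a v)) p (((\<lambda>w. head G (a w)) ^^ m) (head G (a v)))"
    "set p \<subseteq> a ` T" "((\<lambda>w. head G (a w)) ^^ m) (head G (a v)) \<in> T"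
    by blast
  then show ?case
    using a[OF Suc.prems] Suc.prems
    by (intro exI[of _ "a v # p"]) (auto simp: awalk_simps funpow_Suc_right simp del: funpow.simps)
qed

text \<open>Pigeonhole: an orbit in the finite set \<open>T\<close> repeats, and the path between
  two visits is a loop.\<close>

lemma ex_loop_in_finite_set:
  assumes wf: "wf_digraph G"
    and a: "\<And>w. w \<in> T \<Longrightarrow> a w \<in> arcs G \<and> tail G (a w) = w \<and> head G (a w) \<in> T"
    and T: "T \<subseteq> verts G" "finite T" "T \<noteq> {}"
  shows "\<exists>p. is_loop G p \<and> set p \<subseteq> a ` T"
proof -
  let ?f = "\<lambda>w. head G (a w)"
  obtain v where v: "v \<in> T" using T by blast
  have it: "(?f ^^ m) v \<in> T" for m
    using awalk_iterates[OF wf a T(1) v] by blast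
  then have "finite (range (\<lambda>m. (?f ^^ m) v))"
    by (intro finite_subset[OF _ T(2)]) auto
  then have "\<not> inj (\<lambda>m. (?f ^^ m) v)"
    using finite_imageD infinite_UNIV_nat by blast
  then obtain i j where "i < j" and eq: "(?f ^^ i) v = (?f ^^ j) v"
    by (metis (no_types, lifting) injI linorder_neqE_nat)
  let ?w = "(?f ^^ i) v"
  have "(?f ^^ (j - i)) ?w = ?w"
    using \<open>i < j\<close> eq by (metis comp_apply funpow_add le_add_diff_inverse2 less_imp_le)
  moreover obtain p where "length p = j - i" "pre_digraph.awalk G ?w p ((?f ^^ (j - i)) ?w)"
    "set p \<subseteq> a ` T"
    using awalk_iterates[OF wf a T(1) it] by blast
  ultimately show ?thesis
    using \<open>i < j\<close> by (intro exI[of _ p]) (auto simp: is_loop_def)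
qed

lemma ex_path_count_ge_2:
  assumes G: "fin_digraph G" and ns: "\<forall>v\<in>verts G. \<not> is_sink G v" and L: "condition_L G"
    and v: "v \<in> verts G"
  shows "\<exists>k. 2 \<le> path_count G k v"
proof (rule ccontr)
  assume contr: "\<not> ?thesis"
  interpret fin_digraph G by fact
  \<comment> \<open>As there are no sinks, these are the vertices with exactly one path of each
    length.\<close>
  define T where "T = {w \<in> verts G. \<forall>k. path_count G k w < 2}"
  have single: "\<exists>e. out_arcs G w = {e} \<and> head G e \<in> T" if w: "w \<in> T" for w
  proof -
    have "card (out_arcs G w) < 2"
      using w[unfolded T_def, simplified, THEN conjunct2, rule_format, of 1] by simp
    moreover have "out_arcs G w \<noteq> {}"
      using w ns by (auto simp: T_def is_sink_def)
    ultimately have "card (out_arcs G w) = 1"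
      using out_arcs_finite[OF G, of w] card_0_eq[of "out_arcs G w"] by linarith
    then obtain e where e: "out_arcs G w = {e}"
      by (rule card_1_singletonE)
    \<comment> \<open>Every nonempty path from \<open>w\<close> begins with \<open>e\<close>, so the
      bound for all lengths passes on to the range of \<open>e\<close>.\<close>
    then have "path_count G k (head G e) = path_count G (Suc k) w" for k
      by simp
    moreover have "head G e \<in> verts G"
      using e by (metis head_in_verts in_out_arcs_conv insertI1)
    ultimately have "head G e \<in> T"
      using w by (simp add: T_def del: path_count.simps)
    with e show ?thesis by blast
  qed
  then obtain a where a: "\<And>w. w \<in> T \<Longrightarrow> out_arcs G w = {a w} \<and> head G (a w) \<in> T"
    by metis
  have a': "a w \<in> arcs G \<and> tail G (a w) = w \<and> head G (a w) \<in> T" if "w \<in> T" for w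
    using a[OF that] by (metis in_out_arcs_conv insertI1)
  have "v \<in> T"
    using contr v by (auto simp: T_def not_le)
  then obtain p where p: "is_loop G p" "set p \<subseteq> a ` T"
    using ex_loop_in_finite_set[of G T a] a' wf_digraph by (auto simp: T_def)
  then obtain e i where e: "e \<in> arcs G" "i < length p" "tail G e = tail G (p ! i)" "e \<noteq> p ! i"
    using L by (auto simp: condition_L_def has_exit_def)
  \<comment> \<open>The exit \<open>e\<close> shares its source with the loop edge
    \<open>p ! i\<close>, but that source emits only one edge.\<close>
  obtain w where w: "w \<in> T" "p ! i = a w"
    using p e by (meson imageE nth_mem subsetD)
  then have "e \<in> out_arcs G w"
    using e a' by simp
  then show False
    using a[OF w(1)] e w by simp
qed

lemma ex_positive_vector_in_image:
  assumes G: "fin_digraph G" and ns: "\<forall>v\<in>verts G. \<not> is_sink G v" and "condition_L G"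
  shows "\<exists>z. \<forall>v\<in>verts G. 1 \<le> vertex_matrix_minus_id G z v"
proof -
  interpret fin_digraph G by fact
  obtain k where k: "\<And>v. v \<in> verts G \<Longrightarrow> 2 \<le> path_count G (k v) v"
    using ex_path_count_ge_2[OF assms] by metis
  \<comment> \<open>The length \<open>k v\<close> varies with \<open>v\<close>; since counts grow
    with length, the maximum over the finite vertex set serves all vertices.\<close>
  define n where "n = Max (k ` verts G)"
  have "2 \<le> path_count G n v" if v: "v \<in> verts G" for v
  proof -
    have "k v \<le> n"
      using v by (simp add: n_def)
    then show ?thesis
      using k[OF v] path_count_mono[OF G ns v] le_trans by blast
  qed
  then show ?thesis
    by (intro exI[of _ "\<lambda>v. \<Sum>k<n. int (path_count G k v)"])
      (force simp: vertex_matrix_minus_id_path_count_sum[OF G])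
qed

section \<open>Positive representatives of cokernel classes\<close>

lemma carrier_int_power: "carrier (int_power V) = (\<Pi>\<^sub>E v\<in>V. UNIV)"
  by (simp add: int_power_def integer_group_def)

lemma mult_int_power: "x \<otimes>\<^bsub>int_power V\<^esub> y = (\<lambda>v\<in>V. x v + y v)"
  by (simp add: int_power_def integer_group_def)

lemma group_int_power: "group (int_power V)"
  by (simp add: int_power_def)

lemma subgroup_image_subgroup:
  assumes G: "fin_digraph G"
  shows "subgroup (image_subgroup G) (int_power (verts G))"
proof -
  interpret fin_digraph G by fact
  have "vertex_matrix_minus_id G \<in> hom (int_power (verts G)) (int_power (verts G))"
  proof (rule homI)
    fix x y
    show "vertex_matrix_minus_id G x \<in> carrier (int_power (verts G))"
      by (simp add: carrier_int_power vertex_matrix_minus_id_def)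
    show "vertex_matrix_minus_id G (x \<otimes>\<^bsub>int_power (verts G)\<^esub> y) =
        vertex_matrix_minus_id G x \<otimes>\<^bsub>int_power (verts G)\<^esub> vertex_matrix_minus_id G y"
    proof
      fix v
      show "vertex_matrix_minus_id G (x \<otimes>\<^bsub>int_power (verts G)\<^esub> y) v =
          (vertex_matrix_minus_id G x \<otimes>\<^bsub>int_power (verts G)\<^esub> vertex_matrix_minus_id G y) v"
      proof (cases "v \<in> verts G")
        case True
        then show ?thesis
          by (simp add: vertex_matrix_minus_id_eq[OF G] mult_int_power sum.distrib)
      next
        case False
        then show ?thesis
          by (simp add: mult_int_power vertex_matrix_minus_id_def)
      qed
    qed
  qed
  then have "group_hom (int_power (verts G)) (int_power (verts G)) (vertex_matrix_minus_id G)"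
    by (simp add: group_hom_def group_hom_axioms_def group_int_power)
  then show ?thesis
    unfolding image_subgroup_def by (rule group_hom.img_is_subgroup)
qed

text \<open>A large multiple of a positive image vector outweighs the negative entries of a
  representative without changing its class.\<close>

lemma ex_positive_representative:
  assumes G: "fin_digraph G" and "\<forall>v\<in>verts G. \<not> is_sink G v" and "condition_L G"
    and \<xi>: "\<xi> \<in> carrier (coker_vertex_matrix_minus_id G)"
  shows "\<exists>n. (\<forall>v\<in>verts G. 1 \<le> n v) \<and> coker_class G (\<lambda>v. int (n v)) = \<xi>"
proof -
  interpret fin_digraph G by fact
  let ?P = "int_power (verts G)" and ?M = "vertex_matrix_minus_id G"
  obtain x where x: "x \<in> carrier ?P" "\<xi> = image_subgroup G #>\<^bsub>?P\<^esub> x"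
    using \<xi> by (auto simp: coker_vertex_matrix_minus_id_def FactGroup_def RCOSETS_def)
  obtain z where z: "\<And>v. v \<in> verts G \<Longrightarrow> 1 \<le> ?M z v"
    using ex_positive_vector_in_image[OF assms(1-3)] by blast
  \<comment> \<open>\<open>N\<close> is larger than the absolute value of every entry of
    \<open>x\<close>.\<close>
  define N where "N = (\<Sum>v\<in>verts G. \<bar>x v\<bar>) + 1"
  define y where "y = (\<lambda>v\<in>verts G. N * z v)"
  have My: "?M y v = N * ?M z v" if "v \<in> verts G" for v
    using that
    by (simp add: vertex_matrix_minus_id_eq[OF G] y_def sum_distrib_left right_diff_distrib)
  have pos: "1 \<le> ?M y v + x v" if v: "v \<in> verts G" for v
  proof -
    have "\<bar>x v\<bar> \<le> (\<Sum>v\<in>verts G. \<bar>x v\<bar>)"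
      using v by (intro member_le_sum) auto
    then have "1 \<le> N + x v" and "0 \<le> N" by (simp_all add: N_def)
    moreover have "N * 1 \<le> N * ?M z v"
      using z[OF v] \<open>0 \<le> N\<close> by (rule mult_left_mono)
    ultimately show ?thesis by (simp add: My[OF v])
  qed
  define n where "n v = nat (?M y v + x v)" for v
  have eq: "(\<lambda>v\<in>verts G. int (n v)) = ?M y \<otimes>\<^bsub>?P\<^esub> x"
    using pos by (force simp: mult_int_power n_def)
  have "?M y \<in> image_subgroup G"
    by (auto simp: image_subgroup_def carrier_int_power y_def)
  then have "(\<lambda>v\<in>verts G. int (n v)) \<in> image_subgroup G #>\<^bsub>?P\<^esub> x"
    unfolding eq r_coset_def by blast
  \<comment> \<open>A coset is the coset of each of its members.\<close>
  then have "coker_class G (\<lambda>v. int (n v)) = \<xi>"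
    unfolding coker_class_def x(2)
    using group.repr_independence[OF group_int_power _ x(1) subgroup_image_subgroup[OF G]] by simp
  moreover have "1 \<le> n v" if "v \<in> verts G" for v
    using pos[OF that] by (simp add: n_def)
  ultimately show ?thesis by blast
qed

section \<open>Realising a positive vector\<close>

definition attach_sink ::
  "('a, 'b) pre_digraph \<Rightarrow> nat set \<Rightarrow> (nat \<Rightarrow> 'a) \<Rightarrow> ('a + nat, 'b + nat) pre_digraph" where
  "attach_sink G I t =
     \<lparr>verts = insert (Inr 0) (Inl ` verts G), arcs = Inl ` arcs G \<union> Inr ` I,
      tail = case_sum (Inl \<circ> tail G) (Inl \<circ> t),
      head = case_sum (Inl \<circ> head G) (\<lambda>_. Inr 0)\<rparr>"

lemma attach_sink_simps [simp]:
  "verts (attach_sink G I t) = insert (Inr 0) (Inl ` verts G)"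
  "arcs (attach_sink G I t) = Inl ` arcs G \<union> Inr ` I"
  "tail (attach_sink G I t) (Inl e) = Inl (tail G e)"
  "tail (attach_sink G I t) (Inr i) = Inl (t i)"
  "head (attach_sink G I t) (Inl e) = Inl (head G e)"
  "head (attach_sink G I t) (Inr i) = Inr 0"
  by (simp_all add: attach_sink_def)

lemma inl_copy_simps [simp]:
  "verts (inl_copy G) = Inl ` verts G"
  "arcs (inl_copy G) = Inl ` arcs G"
  "tail (inl_copy G) (Inl e) = Inl (tail G e)"
  "head (inl_copy G) (Inl e) = Inl (head G e)"
  by (simp_all add: inl_copy_def)

lemma tail_attach_sink_neq: "tail (attach_sink G I t) e \<noteq> Inr 0"
  by (cases e) simp_all

lemma fin_digraph_inl_copy: "fin_digraph G \<Longrightarrow> fin_digraph (inl_copy G)"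
  by unfold_locales
    (auto simp: fin_digraph.finite_arcs fin_digraph.finite_verts fin_digraph_def
        wf_digraph.head_in_verts wf_digraph.tail_in_verts)

lemma fin_digraph_attach_sink:
  "fin_digraph G \<Longrightarrow> finite I \<Longrightarrow> t ` I \<subseteq> verts G \<Longrightarrow> fin_digraph (attach_sink G I t)"
  by unfold_locales
    (auto simp: fin_digraph.finite_arcs fin_digraph.finite_verts fin_digraph_def
        wf_digraph.head_in_verts wf_digraph.tail_in_verts)

lemma row_finite_if_fin_digraph: "fin_digraph G \<Longrightarrow> row_finite_graph G"
  by (simp add: row_finite_graph_def out_arcs_finite countable_finite fin_digraph.finite_arcs
      fin_digraph.finite_verts fin_digraph.axioms(1))

text \<open>The only new vertex is the sink, so no loop can lie among the new vertices; surjectivity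
  of \<open>t\<close> supplies a one-edge path from every old vertex.\<close>

lemma essential_attach_sink:
  assumes G: "fin_digraph G" and ne: "verts G \<noteq> {}" and ns: "\<forall>v\<in>verts G. \<not> is_sink G v"
    and I: "finite I" "t ` I = verts G"
  shows "essential_one_sink_extension (inl_copy G) (attach_sink G I t) (Inr 0)"
proof -
  let ?E = "attach_sink G I t" and ?G = "inl_copy G"
  interpret E: fin_digraph ?E
    using fin_digraph_attach_sink[OF G, of I t] I by simp
  have H: "verts ?E - verts ?G = {Inr 0}" by auto
  have sink: "is_sink ?E (Inr 0)"
    by (simp add: is_sink_def out_arcs_def tail_attach_sink_neq)
  \<comment> \<open>\<open>G\<close> has a vertex and \<open>t\<close> hits it, so some edge enters
    the new vertex.\<close>
  obtain i where i: "i \<in> I" using ne I by blast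
  then have "Inr i \<in> in_arcs ?E (Inr 0)" by simp
  then have "in_arcs ?E (Inr 0) \<noteq> {}" by blast
  then have nsource: "\<not> is_source ?E (Inr 0)" by (simp add: is_source_def)
  have noloop: "\<not> (is_loop ?E p \<and> (\<forall>e\<in>set p. tail ?E e \<in> {Inr 0}))" for p
    using tail_attach_sink_neq[of G I t] by (cases p) (auto simp: is_loop_def)
  have nosink: "\<not> is_sink ?G w" for w
  proof
    assume "is_sink ?G w"
    then obtain v where v: "v \<in> verts G" "w = Inl v" "out_arcs ?G (Inl v) = {}"
      by (auto simp: is_sink_def)
    then have "out_arcs G v \<noteq> {}" using ns by (auto simp: is_sink_def)
    then obtain e where "e \<in> out_arcs G v" by blast
    then have "Inl e \<in> out_arcs ?G (Inl v)" by simp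
    with v show False by simp
  qed
  have "one_sink_extension ?G ?E (Inr 0)"
    unfolding one_sink_extension_def Let_def H
    using sink nsource noloop nosink row_finite_if_fin_digraph[OF fin_digraph_inl_copy[OF G]]
      row_finite_if_fin_digraph[OF E.fin_digraph_axioms]
    by (auto simp: contains_subgraph_def)
  moreover have "\<exists>p. E.awalk w p (Inr 0)" if w: "w \<in> verts ?G" for w
  proof -
    obtain i where "i \<in> I" "w = Inl (t i)" using w I by auto
    then show ?thesis
      by (intro exI[of _ "[Inr i]"]) (simp add: E.awalk_simps)
  qed
  ultimately show ?thesis
    by (simp add: essential_one_sink_extension_def)
qed

text \<open>Every new edge ends at the sink, which emits nothing, so a path of new edges from
  \<open>Inl w\<close> to the sink is a single edge.\<close>

lemma wojciech_vector_attach_sink: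
  assumes G: "fin_digraph G" and I: "finite I" "t ` I \<subseteq> verts G"
  shows "wojciech_vector (inl_copy G) (attach_sink G I t) (Inr 0) (Inl w) = card {i \<in> I. t i = w}"
proof -
  let ?E = "attach_sink G I t"
  interpret E: fin_digraph ?E
    using fin_digraph_attach_sink[OF G I] .
  have from_sink: "p = []" if "E.awalk (Inr 0) p (Inr 0)" for p
    using that tail_attach_sink_neq[of G I t] by (cases p) (simp, metis E.awalk_Cons_iff)
  have "{p. E.awalk (Inl w) p (Inr 0) \<and> set p \<subseteq> arcs ?E - arcs (inl_copy G)} =
      (\<lambda>i. [Inr i]) ` {i \<in> I. t i = w}" (is "?L = ?R")
  proof
    show "?L \<subseteq> ?R"
    proof
      fix p assume p: "p \<in> ?L"
      then obtain e q where "p = e # q" by (cases p) (auto simp: E.awalk_simps)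
      moreover from p this obtain i where "e = Inr i" by auto
      ultimately show "p \<in> ?R"
        using p from_sink[of q] by (auto simp: E.awalk_simps)
    qed
    show "?R \<subseteq> ?L"
      by (auto simp: E.awalk_simps)
  qed
  then show ?thesis
    by (simp add: wojciech_vector_def card_image inj_on_def)
qed

text \<open>This turns the vector \<open>n\<close> into edge names and sources: the pairs
  \<open>(v, j)\<close> with \<open>j < n v\<close> stand for the edges, are numbered by naturals,
  and \<open>t\<close> takes the first component.\<close>

lemma ex_map_with_fibre_cards:
  fixes n :: "'a \<Rightarrow> nat"
  assumes V: "finite V" and n: "\<forall>v\<in>V. 1 \<le> n v"
  shows "\<exists>(I :: nat set) t. finite I \<and> t ` I = V \<and> (\<forall>v\<in>V. card {i \<in> I. t i = v} = n v)"
proof -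
  let ?P = "SIGMA v:V. {..<n v}"
  obtain h where h: "bij_betw h {..<card ?P} ?P"
    using ex_bij_betw_nat_finite[of ?P] V by (auto simp: atLeast0LessThan)
  \<comment> \<open>Positivity of \<open>n\<close> makes every fibre nonempty, so that
    \<open>t\<close> reaches all of \<open>V\<close>.\<close>
  have "0 \<in> {..<n v}" if "v \<in> V" for v
    using n that by fastforce
  then have fst_P: "fst ` ?P = V"
    unfolding fst_image_Sigma by blast
  have "(fst \<circ> h) ` {..<card ?P} = fst ` ?P"
    using h by (simp add: bij_betw_def flip: image_image)
  also note fst_P
  finally have "(fst \<circ> h) ` {..<card ?P} = V" .
  moreover have "card {i \<in> {..<card ?P}. (fst \<circ> h) i = v} = n v" if "v \<in> V" for v
  proof -
    have "h ` {i \<in> {..<card ?P}. (fst \<circ> h) i = v} = {x \<in> h ` {..<card ?P}. fst x = v}"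
      by auto
    also have "\<dots> = {x \<in> ?P. fst x = v}"
      by (simp only: bij_betw_imp_surj_on[OF h])
    also have "\<dots> = {v} \<times> {..<n v}"
      using that by auto
    finally have image: "h ` {i \<in> {..<card ?P}. (fst \<circ> h) i = v} = {v} \<times> {..<n v}" .
    have "inj_on h {i \<in> {..<card ?P}. (fst \<circ> h) i = v}"
      using h by (auto simp: bij_betw_def inj_on_def)
    from card_image[OF this] show ?thesis
      unfolding image by simp
  qed
  ultimately show ?thesis
    by (intro exI[of _ "{..<card ?P}"] exI[of _ "fst \<circ> h"] conjI ballI) auto
qed

text \<open>The cokernel is that of \<open>G\<close> itself; evaluation at \<open>Inl w\<close>
  carries the vector back from the relabelled copy. The null graph is excluded since it has no
  1-sink extension: H would be finite, nonempty and loop-free, and so contain a source.\<close>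

theorem theorem5p19:
  fixes G :: "('a, 'b) pre_digraph"
    and \<xi> :: "('a \<Rightarrow> int) set"
  assumes "fin_digraph G"
    and "verts G \<noteq> {}"
    and "\<forall>v \<in> verts G. \<not> is_sink G v"
    and "condition_L G"
    and "\<xi> \<in> carrier (coker_vertex_matrix_minus_id G)"
  shows "\<exists>(E :: ('a + nat, 'b + nat) pre_digraph) v0.
           essential_one_sink_extension (inl_copy G) E v0 \<and>
           coker_class G (\<lambda>w. int (wojciech_vector (inl_copy G) E v0 (Inl w))) = \<xi>"
proof -
  obtain n where n: "\<forall>v\<in>verts G. 1 \<le> n v" "coker_class G (\<lambda>v. int (n v)) = \<xi>"
    using ex_positive_representative[OF assms(1,3-5)] by blast
  obtain I :: "nat set" and t where I: "finite I" "t ` I = verts G"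
    and card: "\<And>v. v \<in> verts G \<Longrightarrow> card {i \<in> I. t i = v} = n v"
    using ex_map_with_fibre_cards[OF fin_digraph.finite_verts[OF assms(1)] n(1)] by blast
  \<comment> \<open>The two vectors agree on the vertices, and \<open>coker_class\<close> depends
    only on the values there.\<close>
  have "coker_class G (\<lambda>w. int (wojciech_vector (inl_copy G) (attach_sink G I t) (Inr 0) (Inl w)))
      = coker_class G (\<lambda>v. int (n v))"
    using I by (simp add: coker_class_def wojciech_vector_attach_sink[OF assms(1)] card
        cong: restrict_cong)
  then show ?thesis
    using essential_attach_sink[OF assms(1-3) I] n(2) by blast
qed

end
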